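(* Let $G$ be a non-Hausdorff étale groupoid. (i) Let $f\in\mathcal{C}_c(G)$. Assume that there exist open bisections $V_1,\dots,V_n$ of $G$ and a compact set $K\subseteq V_1\cup\dots\cup V_n$ such that $\mathrm{supp}^\circ(f)\subseteq K$. Then there are $f_1,\dots,f_n$ with $f_i\in C_c(V_i)$ for all $1\le i\le n$ such that $f=f_1+\dots+f_n$. (ii) Assume that $G$ is ample, and let $R$ be a ring. Let $f\in RG$. Assume that there exist open bisections $V_1,\dots,V_n$ of $G$ and a compact set $K\subseteq V_1\cup\dots\cup V_n$ such that $\mathrm{supp}^\circ(f)\subseteq K$. Then there are $f_1,\dots,f_n\in RG$ with $f_i\in C_c(V_i,R)$ for all $1\le i\le n$ such that $f=f_1+\dots+f_n$.
   Context: A groupoid $G$ is a small category all of whose morphisms are invertible, identified with its set of morphisms; $G^{(0)}\subseteq G$ is its set of units and $r,s\colon G\to G^{(0)}$ are range and source. Topological groupoids (continuous range, source, multiplication, inversion) are always assumed locally compact with $G^{(0)}$ Hausdorff in the subspace topology; $G$ itself need not be Hausdorff, and compact subsets need not be closed. $G$ is étale if $r$ is a local homeomorphism, and ample if in addition $G^{(0)}$ is totally disconnected. An open bisection is an open subset $U\subseteq G$ on which $r$ and $s$ are injective ($U$ is then locally compact Hausdorff). For an open bisection $U$, $C_c(U)$ is the set of continuous functions $U\to\mathbb{C}$ with compact support in $U$, extended by zero to functions on $G$; $\mathcal{C}_c(G)$ is the linear span of all $C_c(U)$. Rings need not be commutative or unital. For $G$ ample and a ring $R$, $C_c(U,R)$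 is the set of locally constant functions $U\to R$ with compact support in $U$, extended by zero to $G$; $RG$ is the span of the functions $c_U\colon G\to R$ ($c\in R$, $U\subseteq G$ compact open bisection), where $c_U$ equals $c$ on $U$ and $0$ elsewhere. For a function $f$ on $G$, $\mathrm{supp}^\circ(f)=\{g\in G:f(g)\neq0\}$. *)

theory Defs
  imports
    "HOL-Analysis.Analysis"
    "HOL-Library.Function_Algebras"
    "HOL-Computational_Algebra.Group_Closure"
begin

text \<open>
  A groupoid is given by its set of arrows \<open>A\<close>, the subset \<open>A0\<close> of units, and total functions of
  which only the values on \<open>A\<close> matter; the product \<open>mul g h\<close> is meaningful only if
  \<open>src g = rng h\<close>.
\<close>

locale groupoid =
  fixes A A0 :: "'a set"
    and rng src :: "'a \<Rightarrow> 'a"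
    and mul :: "'a \<Rightarrow> 'a \<Rightarrow> 'a"
    and ginv :: "'a \<Rightarrow> 'a"
  assumes units_subset: "A0 \<subseteq> A"
    and rng_closed: "g \<in> A \<Longrightarrow> rng g \<in> A0"
    and src_closed: "g \<in> A \<Longrightarrow> src g \<in> A0"
    and rng_unit: "u \<in> A0 \<Longrightarrow> rng u = u"
    and src_unit: "u \<in> A0 \<Longrightarrow> src u = u"
    and mul_closed: "\<lbrakk>g \<in> A; h \<in> A; src g = rng h\<rbrakk> \<Longrightarrow> mul g h \<in> A"
    and rng_mul: "\<lbrakk>g \<in> A; h \<in> A; src g = rng h\<rbrakk> \<Longrightarrow> rng (mul g h) = rng g"
    and src_mul: "\<lbrakk>g \<in> A; h \<in> A; src g = rng h\<rbrakk> \<Longrightarrow> src (mul g h) = src h"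
    and mul_assoc: "\<lbrakk>g \<in> A; h \<in> A; k \<in> A; src g = rng h; src h = rng k\<rbrakk>
          \<Longrightarrow> mul (mul g h) k = mul g (mul h k)"
    and mul_rng: "g \<in> A \<Longrightarrow> mul (rng g) g = g"
    and mul_src: "g \<in> A \<Longrightarrow> mul g (src g) = g"
    and ginv_closed: "g \<in> A \<Longrightarrow> ginv g \<in> A"
    and rng_ginv: "g \<in> A \<Longrightarrow> rng (ginv g) = src g"
    and src_ginv: "g \<in> A \<Longrightarrow> src (ginv g) = rng g"
    and mul_ginv_right: "g \<in> A \<Longrightarrow> mul g (ginv g) = rng g"
    and mul_ginv_left: "g \<in> A \<Longrightarrow> mul (ginv g) g = src g"

locale topological_groupoid = groupoid "topspace G" G0 rng src mul ginv
  for G :: "'a topology" and G0 rng src mul ginv +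
  assumes continuous_rng: "continuous_map G (subtopology G G0) rng"
    and continuous_src: "continuous_map G (subtopology G G0) src"
    and continuous_mul:
      "continuous_map
         (subtopology (prod_topology G G)
            {(g, h). g \<in> topspace G \<and> h \<in> topspace G \<and> src g = rng h})
         G (\<lambda>(g, h). mul g h)"
    and continuous_ginv: "continuous_map G G ginv"
    and locally_compact: "locally_compact_space G"
    and Hausdorff_units: "Hausdorff_space (subtopology G G0)"

definition local_homeomorphism :: "'a topology \<Rightarrow> 'b topology \<Rightarrow> ('a \<Rightarrow> 'b) \<Rightarrow> bool"
  where "local_homeomorphism X Y f \<longleftrightarrow>
    f \<in> topspace X \<rightarrow> topspace Y \<and>
    (\<forall>x \<in> topspace X. \<exists>U. openin X U \<and> x \<in> U \<and> openin Y (f ` U) \<and>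
       homeomorphic_map (subtopology X U) (subtopology Y (f ` U)) f)"

definition totally_disconnected_space :: "'a topology \<Rightarrow> bool"
  where "totally_disconnected_space X \<longleftrightarrow> (\<forall>C. connectedin X C \<longrightarrow> (\<exists>x. C \<subseteq> {x}))"

text \<open>\<open>G\<close> itself is not assumed to be Hausdorff.\<close>

locale etale_groupoid = topological_groupoid +
  assumes local_homeomorphism_rng: "local_homeomorphism G (subtopology G G0) rng"

locale ample_groupoid = etale_groupoid +
  assumes totally_disconnected_units: "totally_disconnected_space (subtopology G G0)"

definition open_bisection :: "'a topology \<Rightarrow> ('a \<Rightarrow> 'a) \<Rightarrow> ('a \<Rightarrow> 'a) \<Rightarrow> 'a set \<Rightarrow> bool"
  where "open_bisection G rng src U \<longleftrightarrow> openin G U \<and> inj_on rng U \<and> inj_on src U"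

text \<open>
  Functions on \<open>G\<close> are represented by total functions that vanish off \<open>topspace G\<close>; extension by
  zero from \<open>U\<close> therefore means vanishing at every point outside \<open>U\<close>.
\<close>

definition open_support :: "'a topology \<Rightarrow> ('a \<Rightarrow> 'b::zero) \<Rightarrow> 'a set"
  where "open_support G f = {g \<in> topspace G. f g \<noteq> 0}"

text \<open>
  The support of a function on \<open>U\<close> is the closure taken in \<open>U\<close>: compact subsets of \<open>U\<close> need not be
  closed in \<open>G\<close>.
\<close>

definition compact_support_in :: "'a topology \<Rightarrow> 'a set \<Rightarrow> ('a \<Rightarrow> 'b::zero) \<Rightarrow> bool"
  where "compact_support_in G U f \<longleftrightarrow>
    compactin (subtopology G U) (subtopology G U closure_of {g \<in> U. f g \<noteq> 0})"

definition Cc :: "'a topology \<Rightarrow> 'a set \<Rightarrow> ('a \<Rightarrow> complex) set"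
  where "Cc G U = {f. continuous_map (subtopology G U) euclidean f \<and>
    compact_support_in G U f \<and> (\<forall>g. g \<notin> U \<longrightarrow> f g = 0)}"

interpretation complex_fun: vector_space "\<lambda>(c::complex) (f::'a \<Rightarrow> complex) x. c * f x"
  by standard (auto simp: fun_eq_iff algebra_simps)

definition Cc_groupoid :: "'a topology \<Rightarrow> ('a \<Rightarrow> 'a) \<Rightarrow> ('a \<Rightarrow> 'a) \<Rightarrow> ('a \<Rightarrow> complex) set"
  where "Cc_groupoid G rng src = complex_fun.span (\<Union>U \<in> {U. open_bisection G rng src U}. Cc G U)"

definition locally_constant_on :: "'a topology \<Rightarrow> 'a set \<Rightarrow> ('a \<Rightarrow> 'b) \<Rightarrow> bool"
  where "locally_constant_on G U f \<longleftrightarrow>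
    (\<forall>x \<in> U. \<exists>W. openin (subtopology G U) W \<and> x \<in> W \<and> (\<forall>y \<in> W. f y = f x))"

definition Cc_ring :: "'a topology \<Rightarrow> 'a set \<Rightarrow> ('a \<Rightarrow> 'r::ring) set"
  where "Cc_ring G U = {f. locally_constant_on G U f \<and>
    compact_support_in G U f \<and> (\<forall>g. g \<notin> U \<longrightarrow> f g = 0)}"

text \<open>
  The span of the functions \<open>c\<^sub>U\<close> is the additive group they generate. As \<open>c\<close> runs over all of the
  (possibly non-unital) ring and \<open>r \<cdot> c\<^sub>U = (r c)\<^sub>U\<close>, it is also closed under multiplication by scalars.
\<close>

definition groupoid_ring :: "'a topology \<Rightarrow> ('a \<Rightarrow> 'a) \<Rightarrow> ('a \<Rightarrow> 'a) \<Rightarrow> ('a \<Rightarrow> 'r::ring) set"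
  where "groupoid_ring G rng src =
    group_closure {(\<lambda>g. if g \<in> U then c else 0) | c U. open_bisection G rng src U \<and> compactin G U}"

end

theory Submission
  imports Defs
begin

text \<open>
  A function \<open>f\<close> of the span is a finite sum of summands \<open>g\<^sub>U\<close> supported in open bisections \<open>U\<close>, which
  are locally compact Hausdorff. At a point outside the target sets \<open>V\<^sub>i\<close> and outside all but one of
  the \<open>U\<close>, the remaining summand equals \<open>f\<close> and so vanishes. Hence \<open>g\<^sub>U\<close> is nonzero only on the
  union of the \<open>V\<^sub>i\<close> and the other sets of the decomposition, and it can be split among these; this
  removes one set \<open>U\<close>, and by induction all of them. The pieces of a continuous compactly supported
  \<open>g\<^sub>U\<close> need not have compact support, so for \<open>\<complex>\<close>-valued functions the induction runs over functions
  vanishing at infinity. The compact set \<open>K\<close> then allows the \<open>V\<^sub>i\<close> to be replaced beforehand by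
  relatively compact open subsets. In the ample case compact open sets are available for the
  splitting, and supports stay compact.
\<close>

section \<open>Redistributing a finite sum of sections\<close>

lemma sum_fun_apply: "(\<Sum>i\<in>I. F i) x = (\<Sum>i\<in>I. F i x)"
  by (induction I rule: infinite_finite_induct) (auto simp: zero_fun_def)

text \<open>Distinct indices may carry the same set, while \<open>H\<close> supplies one function
  per set. A set \<open>T\<close> of representatives on which \<open>v\<close> is injective receives
  these functions, and every other index receives \<open>0\<close>.\<close>

lemma ex_indexed_sum:
  fixes H :: "'v \<Rightarrow> 'f::comm_monoid_add"
  assumes "finite I"
    and H: "\<And>i. i \<in> I \<Longrightarrow> H (v i) \<in> S (v i)"
    and zero: "\<And>i. i \<in> I \<Longrightarrow> 0 \<in> S (v i)"
  shows "\<exists>F. (\<forall>i\<in>I. F i \<in> S (v i)) \<and> (\<Sum>W\<in>v ` I. H W) = (\<Sum>i\<in>I. F i)"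
proof -
  obtain T where T: "T \<subseteq> I" "inj_on v T" "v ` T = v ` I"
    by (metis subset_image_inj subset_refl)
  define F where "F i = (if i \<in> T then H (v i) else 0)" for i
  have "(\<Sum>W\<in>v ` I. H W) = (\<Sum>i\<in>T. H (v i))"
    using T(2) by (subst T(3)[symmetric]) (simp add: sum.reindex)
  also have "\<dots> = (\<Sum>i\<in>I. F i)"
    using T(1) \<open>finite I\<close> unfolding F_def by (intro sum.mono_neutral_cong_left) auto
  finally show ?thesis
    using H zero by (intro exI[of _ F]) (simp add: F_def)
qed

text \<open>
  \<open>S U\<close> plays the role of the sections supported in \<open>U\<close>. The axiom \<open>split\<close> replaces partitions of
  unity; its two open sets cover only the points where \<open>f\<close> is nonzero, and they need not belong
  to \<open>\<U>\<close>, as a union of Hausdorff open sets need not be Hausdorff.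
\<close>

locale soft_sections =
  fixes X :: "'a topology"
    and \<U> :: "'a set set"
    and S :: "'a set \<Rightarrow> ('a \<Rightarrow> 'b::ab_group_add) set"
  assumes openin_family: "U \<in> \<U> \<Longrightarrow> openin X U"
    and zero_mem: "U \<in> \<U> \<Longrightarrow> 0 \<in> S U"
    and diff_mem: "\<lbrakk>U \<in> \<U>; f \<in> S U; g \<in> S U\<rbrakk> \<Longrightarrow> f - g \<in> S U"
    and vanish: "\<lbrakk>U \<in> \<U>; f \<in> S U; f x \<noteq> 0\<rbrakk> \<Longrightarrow> x \<in> U"
    and transfer: "\<lbrakk>U \<in> \<U>; W \<in> \<U>; f \<in> S U; \<And>x. f x \<noteq> 0 \<Longrightarrow> x \<in> W\<rbrakk> \<Longrightarrow> f \<in> S W"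
    and split: "\<lbrakk>U \<in> \<U>; f \<in> S U; openin X A; openin X B; \<And>x. f x \<noteq> 0 \<Longrightarrow> x \<in> A \<union> B\<rbrakk>
      \<Longrightarrow> \<exists>a\<in>S U. (\<forall>x. a x \<noteq> 0 \<longrightarrow> x \<in> A) \<and> (\<forall>x. f x - a x \<noteq> 0 \<longrightarrow> x \<in> B)"
begin

lemma add_mem:
  assumes "U \<in> \<U>" "f \<in> S U" "g \<in> S U"
  shows "f + g \<in> S U"
proof -
  have "f - (0 - g) \<in> S U"
    by (intro diff_mem zero_mem assms)
  then show ?thesis by simp
qed

text \<open>This is the sum of the groups \<open>S U\<close> inside all functions. Each set carries
  a single summand, so that an induction on \<open>\<J>\<close> can eliminate one set together with
  everything supported there.\<close>

definition total :: "('a \<Rightarrow> 'b) set"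
  where "total = {\<Sum>U\<in>\<J>. g U | \<J> g. finite \<J> \<and> \<J> \<subseteq> \<U> \<and> (\<forall>U\<in>\<J>. g U \<in> S U)}"

lemma totalE:
  assumes "f \<in> total"
  obtains \<J> g where "finite \<J>" "\<J> \<subseteq> \<U>" "\<forall>U\<in>\<J>. g U \<in> S U" "f = (\<Sum>U\<in>\<J>. g U)"
proof -
  from assms obtain \<J> g where "f = (\<Sum>U\<in>\<J>. g U) \<and> finite \<J> \<and> \<J> \<subseteq> \<U> \<and> (\<forall>U\<in>\<J>. g U \<in> S U)"
    unfolding total_def by (elim CollectE exE)
  then show thesis
    by (intro that[of \<J> g]) simp_all
qed

lemma total_base:
  assumes "U \<in> \<U>" "f \<in> S U"
  shows "f \<in> total"
  unfolding total_def using assms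
  by (intro CollectI exI[of _ "{U}"] exI[of _ "\<lambda>_. f"]) simp

lemma total_zero: "0 \<in> total"
  unfolding total_def by (intro CollectI exI[of _ "{}"]) simp

text \<open>Both decompositions are padded with zero summands to the common index family
  \<open>\<J> \<union> \<J>'\<close> and then subtracted set by set.\<close>

lemma total_diff:
  assumes "f \<in> total" "f' \<in> total"
  shows "f - f' \<in> total"
proof -
  obtain \<J> g where
    J: "finite \<J>" "\<J> \<subseteq> \<U>" "\<forall>U\<in>\<J>. g U \<in> S U" "f = (\<Sum>U\<in>\<J>. g U)"
    by (rule totalE[OF assms(1)])
  obtain \<J>' g' where
    J': "finite \<J>'" "\<J>' \<subseteq> \<U>" "\<forall>U\<in>\<J>'. g' U \<in> S U" "f' = (\<Sum>U\<in>\<J>'. g' U)"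
    by (rule totalE[OF assms(2)])
  define h where "h U = (if U \<in> \<J> then g U else 0)" for U
  define h' where "h' U = (if U \<in> \<J>' then g' U else 0)" for U
  have "f = (\<Sum>U\<in>\<J> \<union> \<J>'. h U)"
    unfolding J(4) h_def using J(1) J'(1) by (intro sum.mono_neutral_cong_left) auto
  moreover have "f' = (\<Sum>U\<in>\<J> \<union> \<J>'. h' U)"
    unfolding J'(4) h'_def using J(1) J'(1) by (intro sum.mono_neutral_cong_left) auto
  ultimately have "f - f' = (\<Sum>U\<in>\<J> \<union> \<J>'. h U - h' U)"
    by (simp only: sum_subtractf)
  moreover have "h U - h' U \<in> S U" if "U \<in> \<J> \<union> \<J>'" for U
  proof -
    have "U \<in> \<U>" using that J(2) J'(2) by auto
    then show ?thesis
      using J(3) J'(3) by (intro diff_mem) (auto simp: h_def h'_def zero_mem)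
  qed
  ultimately show ?thesis
    unfolding total_def using J(1,2) J'(1,2)
    by (intro CollectI exI[of _ "\<J> \<union> \<J>'"] exI[of _ "\<lambda>U. h U - h' U"]) simp
qed

lemma total_add:
  assumes "f \<in> total" "f' \<in> total"
  shows "f + f' \<in> total"
  using total_diff[OF assms(1) total_diff[OF total_zero assms(2)]] by simp

lemma total_vanish:
  assumes "f \<in> total" "f x \<noteq> 0"
  shows "x \<in> topspace X"
proof -
  obtain \<J> g where J: "finite \<J>" "\<J> \<subseteq> \<U>" "\<forall>U\<in>\<J>. g U \<in> S U" "f = (\<Sum>U\<in>\<J>. g U)"
    by (rule totalE[OF assms(1)])
  then obtain U where U: "U \<in> \<J>" "g U x \<noteq> 0"
    using assms(2) by (metis sum_fun_apply sum.neutral)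
  then have "U \<in> \<U>" "x \<in> U"
    using J vanish by blast+
  then show ?thesis
    using openin_family openin_subset by blast
qed

text \<open>The sets of \<open>\<W>\<close> are peeled off one at a time: \<open>split\<close> cuts
  from \<open>f\<close> a piece \<open>a\<close> nonzero only on \<open>W\<close>, and the remainder
  is nonzero only on the union of the other sets. All pieces are produced in \<open>S U\<close>;
  \<open>transfer\<close> then moves \<open>a\<close> to \<open>S W\<close>.\<close>

lemma split_finite:
  assumes "finite \<W>" "\<W> \<subseteq> \<U>" "U \<in> \<U>" "f \<in> S U" "\<And>x. f x \<noteq> 0 \<Longrightarrow> x \<in> \<Union>\<W>"
  shows "\<exists>h. (\<forall>W\<in>\<W>. h W \<in> S W) \<and> f = (\<Sum>W\<in>\<W>. h W)"
  using assms
proof (induction \<W> arbitrary: f rule: finite_induct)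
  case empty
  then have "f = 0" by (auto simp: fun_eq_iff)
  then show ?case by auto
next
  case (insert W \<W>)
  have "openin X W" "openin X (\<Union>\<W>)"
    using insert.prems(1) openin_family by auto
  with split[OF insert.prems(2,3)] insert.prems(4)
  obtain a where a: "a \<in> S U" "\<And>x. a x \<noteq> 0 \<Longrightarrow> x \<in> W" "\<And>x. f x - a x \<noteq> 0 \<Longrightarrow> x \<in> \<Union>\<W>"
    by (metis Union_insert)
  have "\<exists>h. (\<forall>W\<in>\<W>. h W \<in> S W) \<and> f - a = (\<Sum>W\<in>\<W>. h W)"
    using insert.prems a by (intro insert.IH diff_mem) auto
  then obtain h where h: "\<And>W. W \<in> \<W> \<Longrightarrow> h W \<in> S W" "f - a = (\<Sum>W\<in>\<W>. h W)"
    by blast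
  have "a \<in> S W"
    using transfer[OF insert.prems(2) _ a(1,2)] insert.prems(1) by auto
  moreover have "f = (\<Sum>V\<in>insert W \<W>. (h(W := a)) V)"
  proof -
    have "(\<Sum>V\<in>\<W>. (h(W := a)) V) = (\<Sum>V\<in>\<W>. h V)"
      using insert.hyps by (intro sum.cong) auto
    then show ?thesis
      using insert.hyps h(2) by (simp add: algebra_simps)
  qed
  ultimately show ?case
    using h(1) by (intro exI[of _ "h(W := a)"]) auto
qed

text \<open>This is the induction that eliminates the original sets \<open>\<J>\<close>. It is run
  with \<open>f\<close> and the summands \<open>g\<close> generalized, because eliminating one set
  changes both.\<close>

lemma redistribute:
  assumes "f \<in> total" "finite \<V>" "\<V> \<subseteq> \<U>" "\<And>x. f x \<noteq> 0 \<Longrightarrow> x \<in> \<Union>\<V>"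
  shows "\<exists>F. (\<forall>V\<in>\<V>. F V \<in> S V) \<and> f = (\<Sum>V\<in>\<V>. F V)"
proof -
  have "\<exists>F. (\<forall>V\<in>\<V>. F V \<in> S V) \<and> f = (\<Sum>V\<in>\<V>. F V)"
    if "finite \<J>" "\<J> \<subseteq> \<U>" "\<And>U. U \<in> \<J> \<Longrightarrow> g U \<in> S U" "f = (\<Sum>U\<in>\<J>. g U)"
      "\<And>x. f x \<noteq> 0 \<Longrightarrow> x \<in> \<Union>\<V>" for \<J> g f
    using that
  proof (induction \<J> arbitrary: f g rule: finite_induct)
    case empty
    have "(\<Sum>V\<in>\<V>. 0 :: 'a \<Rightarrow> 'b) = 0" by simp
    then show ?case
      using empty.prems(3) zero_mem assms(3)
      by (intro exI[of _ "\<lambda>_. 0"] conjI ballI) (blast, simp only: sum.empty)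
  next
    case (insert U \<J>)
    have f: "f = g U + (\<Sum>W\<in>\<J>. g W)"
      using insert.prems(3) unfolding sum.insert[OF insert.hyps] .
    have "x \<in> \<Union>(\<V> \<union> \<J>)" if "g U x \<noteq> 0" for x
    proof (rule ccontr)
      assume *: "x \<notin> \<Union>(\<V> \<union> \<J>)"
      then have "g W x = 0" if "W \<in> \<J>" for W
        using that vanish insert.prems(1,2) by blast
      then have "f x = g U x"
        by (simp add: f sum_fun_apply)
      with \<open>g U x \<noteq> 0\<close> have "x \<in> \<Union>\<V>"
        using insert.prems(4) by simp
      with * show False by simp
    qed
    then obtain h where h: "\<And>W. W \<in> \<V> \<union> \<J> \<Longrightarrow> h W \<in> S W" "g U = (\<Sum>W\<in>\<V> \<union> \<J>. h W)"
      using split_finite[of "\<V> \<union> \<J>" U "g U"] insert.prems(1,2) insert.hyps(1) assms(2,3)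
      by (metis Un_subset_iff finite_Un insert_subset insertI1)
    \<comment> \<open>The pieces of \<open>g U\<close> on the sets of \<open>\<V>\<close> are
      subtracted from \<open>f\<close>; the others are absorbed into the remaining summands. A set
      lying in both \<open>\<V>\<close> and \<open>\<J>\<close> is counted only on the side of
      \<open>\<V>\<close>.\<close>
    define g' where "g' W = g W + (if W \<in> \<V> then 0 else h W)" for W
    have "(\<Sum>W\<in>\<V> \<union> \<J>. h W) = (\<Sum>W\<in>\<V>. h W) + (\<Sum>W\<in>\<J> - \<V>. h W)"
      using assms(2) insert.hyps(1) by (metis Diff_disjoint Un_Diff_cancel finite_Diff sum.union_disjoint)
    moreover have "(\<Sum>W\<in>\<J>. if W \<in> \<V> then 0 else h W) = (\<Sum>W\<in>\<J> - \<V>. h W)"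
      using insert.hyps(1) by (intro sum.mono_neutral_cong_right) auto
    ultimately have f': "f - (\<Sum>W\<in>\<V>. h W) = (\<Sum>W\<in>\<J>. g' W)"
      unfolding f h(2) g'_def sum.distrib by (simp add: algebra_simps)
    \<comment> \<open>The subtracted pieces vanish off the union of \<open>\<V>\<close>, so the new
      function still vanishes there and the induction hypothesis for \<open>\<J>\<close> and
      \<open>g'\<close> applies.\<close>
    have "\<exists>F. (\<forall>V\<in>\<V>. F V \<in> S V) \<and> f - (\<Sum>W\<in>\<V>. h W) = (\<Sum>V\<in>\<V>. F V)"
    proof (rule insert.IH[OF _ _ f'])
      show "\<J> \<subseteq> \<U>" using insert.prems(1) by simp
      show "g' W \<in> S W" if "W \<in> \<J>" for W
        using that insert.prems(1,2) h(1) unfolding g'_def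
        by (intro add_mem) (auto simp: zero_mem)
      fix x assume x: "(f - (\<Sum>W\<in>\<V>. h W)) x \<noteq> 0"
      show "x \<in> \<Union>\<V>"
      proof (rule ccontr)
        assume *: "x \<notin> \<Union>\<V>"
        then have "h W x = 0" if "W \<in> \<V>" for W
          using that vanish h(1) assms(3) by blast
        then have "(f - (\<Sum>W\<in>\<V>. h W)) x = f x"
          by (simp add: sum_fun_apply)
        with x * insert.prems(4) show False by metis
      qed
    qed
    then obtain F where F: "\<And>V. V \<in> \<V> \<Longrightarrow> F V \<in> S V" "f - (\<Sum>W\<in>\<V>. h W) = (\<Sum>V\<in>\<V>. F V)"
      by blast
    have "f = (\<Sum>V\<in>\<V>. F V + h V)"
      using F(2) by (simp add: sum.distrib algebra_simps)
    moreover have "\<forall>V\<in>\<V>. F V + h V \<in> S V"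
      using F(1) h(1) assms(3) by (auto intro: add_mem)
    ultimately show ?case by (intro exI[of _ "\<lambda>V. F V + h V"] conjI)
  qed
  then show ?thesis
    using totalE[OF assms(1)] assms(4) by metis
qed

end

section \<open>Functions vanishing at infinity\<close>

text \<open>Both separation and local compactness are imposed on \<open>U\<close> alone, since the
  ambient space need not be Hausdorff.\<close>

definition lcH_open :: "'a topology \<Rightarrow> 'a set \<Rightarrow> bool"
  where "lcH_open X U \<longleftrightarrow> openin X U \<and> locally_compact_space (subtopology X U) \<and>
    Hausdorff_space (subtopology X U)"

lemma lcH_open_subset:
  assumes "lcH_open X U" "openin X W" "W \<subseteq> U"
  shows "lcH_open X W"
proof -
  have "openin (subtopology X U) W"
    using assms by (simp add: openin_subset_topspace_eq lcH_open_def openin_open_subtopology)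
  then have "locally_compact_space (subtopology (subtopology X U) W)"
    using assms(1) unfolding lcH_open_def by (blast intro: locally_compact_space_open_subset)
  moreover have "Hausdorff_space (subtopology (subtopology X U) W)"
    using assms(1) unfolding lcH_open_def by (blast intro: Hausdorff_space_subtopology)
  ultimately show ?thesis
    using assms by (simp add: lcH_open_def subtopology_subtopology Int_absorb1)
qed

text \<open>A compact set need not be closed in \<open>X\<close>, but it is closed in the Hausdorff
  subspace \<open>U\<close>; its complement there is open in \<open>U\<close>, hence in
  \<open>X\<close>.\<close>

lemma openin_Diff_compactin:
  assumes "openin X U" "Hausdorff_space (subtopology X U)" "compactin X K" "K \<subseteq> U"
  shows "openin X (U - K)"
proof -
  have "closedin (subtopology X U) K"
    using assms by (intro compactin_imp_closedin) (auto simp: compactin_subtopology)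
  then show ?thesis
    using assms(1) by (metis closedin_def openin_open_subtopology openin_subset inf.absorb2 topspace_subtopology)
qed

lemma continuous_map_metric_iff:
  fixes f :: "'a \<Rightarrow> 'b::metric_space"
  shows "continuous_map X euclidean f \<longleftrightarrow>
    (\<forall>x\<in>topspace X. \<forall>e>0. \<exists>U. openin X U \<and> x \<in> U \<and> (\<forall>y\<in>U. dist (f x) (f y) < e))"
  using Met_TC.continuous_map_to_metric[of X f] by simp

text \<open>Compactly supported functions would violate \<open>transfer\<close>: a function nonzero
  only on \<open>W\<close> can have a closed support that leaves \<open>W\<close>. The superlevel
  sets for \<open>e > 0\<close> do stay inside \<open>W\<close>.\<close>

definition C0 :: "'a topology \<Rightarrow> 'a set \<Rightarrow> ('a \<Rightarrow> 'b::real_normed_vector) set"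
  where "C0 X U = {f. continuous_map (subtopology X U) euclidean f \<and> (\<forall>x. x \<notin> U \<longrightarrow> f x = 0) \<and>
    (\<forall>e>0. compactin X {x \<in> U. e \<le> norm (f x)})}"

text \<open>Vanishing at infinity is continuity at the added point with value \<open>0\<close>. This
  reduces algebraic closure to that of continuous functions and makes a compact Hausdorff, hence
  normal, space available.\<close>

lemma C0_iff_Alexandroff:
  fixes f :: "'a \<Rightarrow> 'b::real_normed_vector"
  assumes "lcH_open X U"
  shows "f \<in> C0 X U \<longleftrightarrow> (\<forall>x. x \<notin> U \<longrightarrow> f x = 0) \<and>
    continuous_map (Alexandroff_compactification (subtopology X U)) euclidean (case_option 0 f)"
    (is "_ \<longleftrightarrow> ?v \<and> continuous_map ?Y euclidean ?f")
proof -
  have top: "topspace X \<inter> U = U"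
    using assms by (simp add: lcH_open_def openin_subset Int_absorb1)
  have "continuous_map ?Y euclidean ?f"
    if f: "continuous_map (subtopology X U) euclidean f"
      and K: "\<And>e. e > 0 \<Longrightarrow> compactin X {x \<in> U. e \<le> norm (f x)}"
    unfolding continuous_map_metric_iff
  proof (intro ballI allI impI)
    fix y and e :: real assume y: "y \<in> topspace ?Y" and e: "e > 0"
    show "\<exists>V. openin ?Y V \<and> y \<in> V \<and> (\<forall>z\<in>V. dist (?f y) (?f z) < e)"
    proof (cases y)
      case None
      \<comment> \<open>The complement of this set is the required neighbourhood of the added point:
        it is compact by assumption, and closed because \<open>U\<close> is Hausdorff.\<close>
      let ?K = "{x \<in> U. e \<le> norm (f x)}"
      have "compactin (subtopology X U) ?K"
        using K[OF e] by (auto simp: compactin_subtopology)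
      moreover have "closedin (subtopology X U) ?K"
        using calculation assms unfolding lcH_open_def by (blast intro: compactin_imp_closedin)
      ultimately have "openin ?Y (insert None (Some ` (topspace (subtopology X U) - ?K)))"
        unfolding openin_Alexandroff_compactification by blast
      then show ?thesis
        using None e by (intro exI[of _ "insert None (Some ` (topspace (subtopology X U) - ?K))"])
          (auto simp: top)
    next
      case (Some x)
      then have "x \<in> topspace (subtopology X U)" using y by auto
      then obtain V where "openin (subtopology X U) V" "x \<in> V" "\<forall>z\<in>V. dist (f x) (f z) < e"
        using f e unfolding continuous_map_metric_iff by blast
      then show ?thesis
        using Some by (intro exI[of _ "Some ` V"]) auto
    qed
  qed
  moreover have "continuous_map (subtopology X U) euclidean f"
    if "continuous_map ?Y euclidean ?f"
  proof -
    have "continuous_map (subtopology X U) euclidean (?f \<circ> Some)"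
      using continuous_map_Some that by (rule continuous_map_compose)
    then show ?thesis by (simp add: o_def)
  qed
  moreover have "compactin X {x \<in> U. e \<le> norm (f x)}"
    if "continuous_map ?Y euclidean ?f" "e > 0" for e
  proof -
    have "closedin ?Y {y \<in> topspace ?Y. ?f y \<in> {b. e \<le> norm b}}"
      using that(1) by (rule closedin_continuous_map_preimage)
        (auto intro!: closed_Collect_le continuous_intros simp flip: closed_closedin)
    \<comment> \<open>Since \<open>e > 0\<close>, the value \<open>0\<close> excludes
      \<open>None\<close>, and closed sets of the compactification that miss \<open>None\<close> are
      images of closed compact subsets of \<open>U\<close>.\<close>
    moreover have "{y \<in> topspace ?Y. ?f y \<in> {b. e \<le> norm b}} = Some ` {x \<in> U. e \<le> norm (f x)}"
      using that(2) by (auto simp: top)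
    ultimately show ?thesis
      by (simp add: compactin_subtopology)
  qed
  ultimately show ?thesis
    unfolding C0_def by blast
qed

lemma C0_zero: "0 \<in> C0 X U"
  by (simp add: C0_def zero_fun_def)

lemma C0_diff:
  fixes f g :: "'a \<Rightarrow> 'b::real_normed_vector"
  assumes "lcH_open X U" "f \<in> C0 X U" "g \<in> C0 X U"
  shows "f - g \<in> C0 X U"
proof -
  have "case_option 0 (f - g) = (\<lambda>y. case_option 0 f y - case_option 0 g y)"
    by (auto simp: fun_eq_iff split: option.split)
  then show ?thesis
    using assms(2,3) by (simp add: C0_iff_Alexandroff[OF assms(1)] continuous_map_diff)
qed

lemma C0_scale:
  fixes f :: "'a \<Rightarrow> 'b::real_normed_field"
  assumes "f \<in> C0 X U"
  shows "(\<lambda>x. c * f x) \<in> C0 X U"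
proof (cases "c = 0")
  case True
  then show ?thesis using C0_zero[of X U] by (simp add: zero_fun_def)
next
  case False
  have "continuous_map (subtopology X U) euclidean ((\<lambda>z. c * z) \<circ> f)"
    using assms by (intro continuous_map_compose[of _ euclidean]) (auto simp: C0_def intro!: continuous_intros)
  moreover have "compactin X {x \<in> U. e \<le> norm (c * f x)}" if "e > 0" for e
  proof -
    have "{x \<in> U. e \<le> norm (c * f x)} = {x \<in> U. e / norm c \<le> norm (f x)}"
      using False by (simp add: norm_mult pos_divide_le_eq mult.commute)
    then show ?thesis
      using assms False that by (simp add: C0_def)
  qed
  ultimately show ?thesis
    using assms by (simp add: C0_def o_def)
qed

text \<open>Only continuity at a point of \<open>W\<close> outside \<open>U\<close> is delicate.
  There \<open>f\<close> is \<open>0\<close>, and removing from \<open>W\<close> the compact set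
  where the norm is at least \<open>e\<close> leaves a neighbourhood of the point, because
  \<open>W\<close> is Hausdorff.\<close>

lemma C0_transfer:
  fixes f :: "'a \<Rightarrow> 'b::real_normed_vector"
  assumes U: "openin X U" and W: "lcH_open X W" and f: "f \<in> C0 X U"
    and supp: "\<And>x. f x \<noteq> 0 \<Longrightarrow> x \<in> W"
  shows "f \<in> C0 X W"
proof -
  have oW: "openin X W" and top: "topspace X \<inter> U = U" "topspace X \<inter> W = W"
    using U W by (auto simp: lcH_open_def dest: openin_subset)
  have fU: "continuous_map (subtopology X U) euclidean f" and f0: "\<And>x. x \<notin> U \<Longrightarrow> f x = 0"
    and K: "\<And>e. e > 0 \<Longrightarrow> compactin X {x \<in> U. e \<le> norm (f x)}"
    using f by (auto simp: C0_def)
  have eq: "{x \<in> U. e \<le> norm (f x)} = {x \<in> W. e \<le> norm (f x)}" if "e > 0" for e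
  proof -
    have "f x \<noteq> 0" if "e \<le> norm (f x)" for x
      using that \<open>e > 0\<close> by auto
    then show ?thesis
      using f0 supp by blast
  qed
  have "continuous_map (subtopology X W) euclidean f"
    unfolding continuous_map_metric_iff
  proof (intro ballI allI impI)
    fix x and e :: real assume x: "x \<in> topspace (subtopology X W)" and e: "e > 0"
    show "\<exists>V. openin (subtopology X W) V \<and> x \<in> V \<and> (\<forall>y\<in>V. dist (f x) (f y) < e)"
    proof (cases "x \<in> U")
      case True
      then obtain V where V: "openin (subtopology X U) V" "x \<in> V" "\<forall>y\<in>V. dist (f x) (f y) < e"
        using fU e unfolding continuous_map_metric_iff topspace_subtopology top by blast
      then have "openin X (V \<inter> W)"
        using U oW by (metis openin_Int openin_trans_full)
      then have "openin (subtopology X W) (V \<inter> W)"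
        by (metis inf_le2 oW openin_open_subtopology)
      then show ?thesis
        using V x top by (intro exI[of _ "V \<inter> W"]) auto
    next
      case False
      have "openin X (W - {x \<in> W. e \<le> norm (f x)})"
        using oW W K[OF e] unfolding eq[OF e] lcH_open_def by (intro openin_Diff_compactin) auto
      then have "openin (subtopology X W) (W - {x \<in> W. e \<le> norm (f x)})"
        by (metis Diff_subset oW openin_open_subtopology)
      then show ?thesis
        using False x e f0 top by (intro exI[of _ "W - {x \<in> W. e \<le> norm (f x)}"]) auto
    qed
  qed
  then show ?thesis
    using K supp unfolding C0_def by (auto simp: eq[symmetric])
qed

text \<open>
  The functions prescribed off \<open>A\<close> (namely \<open>0\<close>) and off \<open>B\<close> (namely \<open>f\<close>) agree where both are
  prescribed, so Tietze's theorem on the one-point compactification extends them.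
\<close>

lemma C0_split_real:
  fixes f :: "'a \<Rightarrow> real"
  assumes U: "lcH_open X U" and f: "f \<in> C0 X U" and A: "openin X A" and B: "openin X B"
    and supp: "\<And>x. f x \<noteq> 0 \<Longrightarrow> x \<in> A \<union> B"
  shows "\<exists>a\<in>C0 X U. (\<forall>x. a x \<noteq> 0 \<longrightarrow> x \<in> A) \<and> (\<forall>x. f x - a x \<noteq> 0 \<longrightarrow> x \<in> B)"
proof -
  define Y where "Y = Alexandroff_compactification (subtopology X U)"
  have top: "topspace X \<inter> U = U"
    using U by (simp add: lcH_open_def openin_subset Int_absorb1)
  have topY: "topspace Y = insert None (Some ` U)"
    by (simp add: Y_def top)
  have "Hausdorff_space Y" "compact_space Y"
    using U by (auto simp: Y_def lcH_open_def Hausdorff_space_Alexandroff_compactification)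
  then have normal: "normal_space Y"
    by (blast intro: compact_Hausdorff_or_regular_imp_normal_space)
  \<comment> \<open>The complement is formed in the compactification, so \<open>P D\<close> contains
    \<open>None\<close> along with the points of \<open>U\<close> outside \<open>D\<close>.\<close>
  define P where "P D = topspace Y - Some ` (U \<inter> D)" for D
  have closed: "closedin Y (P D)" if "openin X D" for D
  proof -
    have "openin (subtopology X U) (U \<inter> D)"
      using that by (simp add: openin_subtopology_Int2)
    then have "openin Y (Some ` (U \<inter> D))"
      by (simp add: Y_def)
    then show ?thesis unfolding P_def by (intro closedin_diff closedin_topspace)
  qed
  define T where "T b = (if b then P A else P B)" for b
  define \<phi> where "\<phi> b = (if b then \<lambda>_. 0 else case_option 0 f)" for b
  define \<psi> where "\<psi> y = (if y \<in> P A then 0 else case_option 0 f y)" for y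
  have f0: "x \<notin> U \<Longrightarrow> f x = 0" for x
    using f by (simp add: C0_def)
  have fY: "continuous_map Y euclidean (case_option 0 f)"
    using f by (simp add: C0_iff_Alexandroff[OF U] Y_def)
  have agree: "case_option 0 f y = 0" if "y \<in> P A" "y \<in> P B" for y
    using that supp by (cases y) (auto simp: P_def topY)
  have "continuous_map (subtopology Y (P A \<union> P B)) euclidean \<psi>"
  proof (rule pasting_lemma_closed[of "{True, False}" _ T _ \<phi>])
    show "finite {True, False}" by simp
    show "closedin (subtopology Y (P A \<union> P B)) (T i)" for i
      using closed[OF A] closed[OF B] by (auto simp: T_def intro: closedin_closed_subtopology[THEN iffD2] closedin_Un)
    show "continuous_map (subtopology (subtopology Y (P A \<union> P B)) (T i)) euclidean (\<phi> i)" for i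
      using fY by (auto simp: \<phi>_def intro: continuous_map_from_subtopology)
    show "\<phi> i x = \<phi> j x" if "x \<in> topspace (subtopology Y (P A \<union> P B)) \<inter> T i \<inter> T j" for i j x
      using that agree by (auto simp: \<phi>_def T_def split: if_splits)
    show "\<exists>j. j \<in> {True, False} \<and> x \<in> T j \<and> \<psi> x = \<phi> j x"
      if "x \<in> topspace (subtopology Y (P A \<union> P B))" for x
      using that by (cases "x \<in> P A") (auto simp: \<phi>_def T_def \<psi>_def)
  qed
  moreover have "closedin Y (P A \<union> P B)"
    using closed[OF A] closed[OF B] by (rule closedin_Un)
  ultimately obtain h where h: "continuous_map Y euclideanreal h"
      "\<And>y. y \<in> P A \<union> P B \<Longrightarrow> h y = \<psi> y"
    using Tietze_extension_realinterval[OF normal, of "P A \<union> P B" UNIV \<psi>]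
    by (metis empty_not_UNIV is_interval_univ subset_UNIV)
  define a where "a x = (if x \<in> U then h (Some x) else 0)" for x
  have hA: "h y = 0" if "y \<in> P A" for y
    using that h(2) by (simp add: \<psi>_def)
  have hB: "h y = case_option 0 f y" if "y \<in> P B" for y
    using that h(2) agree by (simp add: \<psi>_def)
  \<comment> \<open>The extension \<open>h\<close> is \<open>0\<close> on \<open>P A\<close>, hence
    at the added point; this is what makes \<open>a\<close> vanish at infinity.\<close>
  have "None \<in> P A"
    by (simp add: P_def topY)
  then have ha: "case_option 0 a y = h y" if "y \<in> topspace Y" for y
    using that hA by (cases y) (auto simp: topY a_def)
  have "continuous_map Y euclidean (case_option 0 a)"
    using continuous_map_eq[OF h(1)] ha by metis
  then have "a \<in> C0 X U"
    by (simp add: C0_iff_Alexandroff[OF U] Y_def a_def)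
  moreover have "a x = 0" if "x \<notin> A" for x
    using that hA[of "Some x"] by (auto simp: a_def P_def topY)
  moreover have "f x - a x = 0" if "x \<notin> B" for x
    using that hB[of "Some x"] f0 by (auto simp: a_def P_def topY image_iff)
  ultimately show ?thesis
    by blast
qed

text \<open>Real and imaginary parts are nonzero only where \<open>f\<close> is, so each can be
  split by the real case, and the two pieces recombine to a complex one.\<close>

lemma C0_split_complex:
  fixes f :: "'a \<Rightarrow> complex"
  assumes U: "lcH_open X U" and f: "f \<in> C0 X U" and A: "openin X A" and B: "openin X B"
    and supp: "\<And>x. f x \<noteq> 0 \<Longrightarrow> x \<in> A \<union> B"
  shows "\<exists>a\<in>C0 X U. (\<forall>x. a x \<noteq> 0 \<longrightarrow> x \<in> A) \<and> (\<forall>x. f x - a x \<noteq> 0 \<longrightarrow> x \<in> B)"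
proof -
  let ?Y = "Alexandroff_compactification (subtopology X U)"
  have fY: "continuous_map ?Y euclidean (case_option 0 f)" and f0: "\<And>x. x \<notin> U \<Longrightarrow> f x = 0"
    using f by (auto simp: C0_iff_Alexandroff[OF U])
  have part: "(\<lambda>x. p (f x)) \<in> C0 X U" if p: "continuous_map euclidean euclideanreal p" "p 0 = 0" for p
  proof -
    have "case_option 0 (\<lambda>x. p (f x)) = p \<circ> case_option 0 f"
      using p(2) by (auto simp: fun_eq_iff split: option.split)
    then show ?thesis
      using continuous_map_compose[OF fY p(1)] f0 p(2) by (simp add: C0_iff_Alexandroff[OF U])
  qed
  have re: "(\<lambda>x. Re (f x)) \<in> C0 X U" and im: "(\<lambda>x. Im (f x)) \<in> C0 X U"
    by (rule part; auto intro: continuous_intros)+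
  have suppc: "x \<in> A \<union> B" if "Re (f x) \<noteq> 0 \<or> Im (f x) \<noteq> 0" for x
    using supp[of x] that by fastforce
  have "\<exists>a\<in>C0 X U. (\<forall>x. a x \<noteq> 0 \<longrightarrow> x \<in> A) \<and> (\<forall>x. Re (f x) - a x \<noteq> 0 \<longrightarrow> x \<in> B)"
    using suppc by (intro C0_split_real[OF U re A B]) blast
  then obtain a where
    a: "a \<in> C0 X U" "\<forall>x. a x \<noteq> 0 \<longrightarrow> x \<in> A" "\<forall>x. Re (f x) - a x \<noteq> 0 \<longrightarrow> x \<in> B"
    by (elim bexE conjE)
  have "\<exists>b\<in>C0 X U. (\<forall>x. b x \<noteq> 0 \<longrightarrow> x \<in> A) \<and> (\<forall>x. Im (f x) - b x \<noteq> 0 \<longrightarrow> x \<in> B)"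
    using suppc by (intro C0_split_real[OF U im A B]) blast
  then obtain b where
    b: "b \<in> C0 X U" "\<forall>x. b x \<noteq> 0 \<longrightarrow> x \<in> A" "\<forall>x. Im (f x) - b x \<noteq> 0 \<longrightarrow> x \<in> B"
    by (elim bexE conjE)
  have "continuous_map ?Y euclidean (\<lambda>y. Complex (case_option 0 a y) (case_option 0 b y))"
    using a(1) b(1) unfolding C0_iff_Alexandroff[OF U] continuous_map_atin
    by (auto intro!: tendsto_Complex)
  moreover have "(\<lambda>y. Complex (case_option 0 a y) (case_option 0 b y)) =
      case_option 0 (\<lambda>x. Complex (a x) (b x))"
    by (auto simp: fun_eq_iff zero_complex.code split: option.split)
  ultimately have "(\<lambda>x. Complex (a x) (b x)) \<in> C0 X U"
    using a(1) b(1) by (simp add: C0_iff_Alexandroff[OF U] zero_complex.code)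
  then show ?thesis
    using a(2,3) b(2,3)
    by (intro bexI[of _ "\<lambda>x. Complex (a x) (b x)"]) (simp add: complex_eq_iff; blast)
qed

interpretation C0: soft_sections X "{U. lcH_open X U}" "C0 X :: 'a set \<Rightarrow> ('a \<Rightarrow> complex) set"
  for X :: "'a topology"
proof
  fix U W :: "'a set" and f :: "'a \<Rightarrow> complex"
  show "f \<in> C0 X W" if "U \<in> {U. lcH_open X U}" "W \<in> {U. lcH_open X U}" "f \<in> C0 X U" "\<And>x. f x \<noteq> 0 \<Longrightarrow> x \<in> W"
    using that(2,4) by (intro C0_transfer[OF _ _ that(3)]) (use that(1) in \<open>auto simp: lcH_open_def\<close>)
next
  fix U A B :: "'a set" and f :: "'a \<Rightarrow> complex"
  show "\<exists>a\<in>C0 X U. (\<forall>x. a x \<noteq> 0 \<longrightarrow> x \<in> A) \<and> (\<forall>x. f x - a x \<noteq> 0 \<longrightarrow> x \<in> B)"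
    if "U \<in> {U. lcH_open X U}" "f \<in> C0 X U" "openin X A" "openin X B" "\<And>x. f x \<noteq> 0 \<Longrightarrow> x \<in> A \<union> B"
    using that(1) by (intro C0_split_complex[OF _ that(2-5)]) simp
next
  fix U :: "'a set" and f :: "'a \<Rightarrow> complex" and x
  show "x \<in> U" if "f \<in> C0 X U" "f x \<noteq> 0"
    using that by (auto simp: C0_def)
qed (auto simp: lcH_open_def intro: C0_zero C0_diff)

text \<open>For \<open>e > 0\<close> the superlevel set is closed in \<open>U\<close> and contained
  in the compact support, hence compact.\<close>

lemma Cc_subset_C0:
  assumes "openin X U"
  shows "Cc X U \<subseteq> C0 X U"
proof
  fix f assume f: "f \<in> Cc X U"
  have top: "topspace X \<inter> U = U"
    using assms by (simp add: openin_subset Int_absorb1)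
  have "compactin X {x \<in> U. e \<le> norm (f x)}" if "e > 0" for e
  proof -
    let ?K = "subtopology X U closure_of {x \<in> U. f x \<noteq> 0}"
    have "closedin (subtopology X U) {x \<in> topspace (subtopology X U). f x \<in> {z. e \<le> norm z}}"
      using f by (intro closedin_continuous_map_preimage[of _ euclidean])
        (auto simp: Cc_def intro!: closed_Collect_le continuous_intros simp flip: closed_closedin)
    then have "closedin (subtopology X U) {x \<in> U. e \<le> norm (f x)}"
      by (simp add: top)
    moreover have "{x \<in> U. e \<le> norm (f x)} \<subseteq> ?K"
    proof -
      have "{x \<in> U. e \<le> norm (f x)} \<subseteq> {x \<in> U. f x \<noteq> 0}"
        using \<open>e > 0\<close> by auto
      also have "\<dots> \<subseteq> ?K"
        by (rule closure_of_subset) (auto simp: top)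
      finally show ?thesis .
    qed
    moreover have "compactin (subtopology X U) ?K"
      using f by (simp add: Cc_def compact_support_in_def)
    ultimately have "compactin (subtopology X U) {x \<in> U. e \<le> norm (f x)}"
      by (simp add: closed_compactin[of _ ?K])
    then show ?thesis
      by (simp add: compactin_subtopology)
  qed
  then show "f \<in> C0 X U"
    using f by (simp add: C0_def Cc_def)
qed

section \<open>Shrinking covers and recovering compact supports\<close>

lemma lcH_open_nbhd:
  assumes "lcH_open X U" "x \<in> U"
  obtains N C where "openin X N" "compactin X C" "x \<in> N" "N \<subseteq> C" "C \<subseteq> U"
proof -
  have U: "openin X U" "locally_compact_space (subtopology X U)"
    using assms(1) by (simp_all add: lcH_open_def)
  have "x \<in> topspace (subtopology X U)"
    using assms(2) openin_subset[OF U(1)] by auto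
  then obtain N C where NC: "openin (subtopology X U) N" "compactin (subtopology X U) C" "x \<in> N" "N \<subseteq> C"
    using U(2) unfolding locally_compact_space_def by meson
  show thesis
    using that[OF openin_trans_full[OF NC(1) U(1)] _ NC(3,4)] NC(2) by (simp add: compactin_subtopology)
qed

text \<open>Each point of \<open>K\<close> has an open neighbourhood inside a compact subset of some
  \<open>V i\<close>. Finitely many of these neighbourhoods cover \<open>K\<close>; grouping them by
  the chosen index gives \<open>V' i\<close>, and the finite union of the corresponding compact sets
  gives \<open>C i\<close>.\<close>

lemma shrink_cover:
  assumes "finite I" and V: "\<And>i. i \<in> I \<Longrightarrow> lcH_open X (V i)"
    and K: "compactin X K" "K \<subseteq> (\<Union>i\<in>I. V i)"
  obtains V' C where "\<And>i. i \<in> I \<Longrightarrow> openin X (V' i)" "\<And>i. i \<in> I \<Longrightarrow> compactin X (C i)"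
    "\<And>i. i \<in> I \<Longrightarrow> V' i \<subseteq> C i" "\<And>i. i \<in> I \<Longrightarrow> C i \<subseteq> V i" "K \<subseteq> (\<Union>i\<in>I. V' i)"
proof -
  have "\<exists>i\<in>I. \<exists>N C. openin X N \<and> compactin X C \<and> x \<in> N \<and> N \<subseteq> C \<and> C \<subseteq> V i" if x: "x \<in> K" for x
  proof -
    obtain i where i: "i \<in> I" "x \<in> V i"
      using K(2) x by blast
    obtain N C where "openin X N" "compactin X C" "x \<in> N" "N \<subseteq> C" "C \<subseteq> V i"
      using lcH_open_nbhd[OF V[OF i(1)] i(2)] .
    with i(1) show ?thesis by blast
  qed
  \<comment> \<open>The choice \<open>\<iota>\<close> assigns each point a single index, by which
    the finite subcover is later sorted.\<close>
  then obtain \<iota> N C where *: "\<And>x. x \<in> K \<Longrightarrow> \<iota> x \<in> I \<and> openin X (N x) \<and> compactin X (C x) \<and> x \<in> N x \<and> N x \<subseteq> C x \<and> C x \<subseteq> V (\<iota> x)"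
    by metis
  have "\<exists>\<F>. finite \<F> \<and> \<F> \<subseteq> N ` K \<and> K \<subseteq> \<Union>\<F>"
    using * by (intro compactinD[OF K(1)]) auto
  then obtain \<F> where \<F>: "finite \<F>" "\<F> \<subseteq> N ` K" "K \<subseteq> \<Union>\<F>"
    by blast
  obtain T where T: "T \<subseteq> K" "finite T" "\<F> = N ` T"
    using finite_subset_image[OF \<F>(1,2)] by blast
  have cov: "K \<subseteq> (\<Union>x\<in>T. N x)"
    using \<F>(3) T(3) by simp
  show thesis
  proof
    show "openin X (\<Union>x\<in>{x\<in>T. \<iota> x = i}. N x)" for i
      using * T(1) by (intro openin_Union) auto
    show "compactin X (\<Union>x\<in>{x\<in>T. \<iota> x = i}. C x)" for i
      using * T(1,2) by (intro compactin_Union) auto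
    show "(\<Union>x\<in>{x\<in>T. \<iota> x = i}. N x) \<subseteq> (\<Union>x\<in>{x\<in>T. \<iota> x = i}. C x)" for i
      using * T(1) by blast
    show "(\<Union>x\<in>{x\<in>T. \<iota> x = i}. C x) \<subseteq> V i" for i
      using * T(1) by blast
    show "K \<subseteq> (\<Union>i\<in>I. \<Union>x\<in>{x\<in>T. \<iota> x = i}. N x)"
    proof
      fix x assume "x \<in> K"
      then obtain t where "t \<in> T" "x \<in> N t"
        using cov by blast
      then show "x \<in> (\<Union>i\<in>I. \<Union>x\<in>{x\<in>T. \<iota> x = i}. N x)"
        using * T(1) by (intro UN_I[of "\<iota> t"]) auto
    qed
  qed
qed

text \<open>The compact set \<open>C\<close> is closed in the Hausdorff space \<open>V\<close>, so
  it contains the closure in \<open>V\<close> of the points where \<open>f\<close> is nonzero. This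
  turns vanishing at infinity on \<open>V'\<close> into compact support in \<open>V\<close>.\<close>

lemma C0_mem_Cc:
  assumes V: "lcH_open X V" and V': "lcH_open X V'" and C: "V' \<subseteq> C" "C \<subseteq> V" "compactin X C"
    and f: "f \<in> C0 X V'"
  shows "f \<in> Cc X V"
proof -
  have supp: "x \<in> V'" if "f x \<noteq> 0" for x
    using f that by (auto simp: C0_def)
  have "openin X V'"
    using V' by (simp add: lcH_open_def)
  then have "f \<in> C0 X V"
    using supp C by (intro C0_transfer[OF _ V f]) auto
  moreover have "compact_support_in X V f"
    unfolding compact_support_in_def
  proof (rule closed_compactin)
    show C': "compactin (subtopology X V) C"
      using C by (simp add: compactin_subtopology)
    have "closedin (subtopology X V) C"
      using V C' by (simp add: lcH_open_def compactin_imp_closedin)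
    then show "subtopology X V closure_of {x \<in> V. f x \<noteq> 0} \<subseteq> C"
      using supp C by (intro closure_of_minimal) auto
  qed simp
  ultimately show ?thesis
    by (simp add: C0_def Cc_def)
qed

section \<open>Locally constant functions with compact support\<close>

definition zd_open :: "'a topology \<Rightarrow> 'a set \<Rightarrow> bool"
  where "zd_open X U \<longleftrightarrow> lcH_open X U \<and> totally_disconnected_space (subtopology X U)"

text \<open>Total disconnectedness makes \<open>{x}\<close> a connected component of
  \<open>U\<close>. In a locally compact Hausdorff space a compact component has a clopen
  neighbourhood inside any given open one; choosing the latter inside a compact set \<open>C\<close>
  makes the clopen set compact.\<close>

lemma zd_open_compact_open:
  assumes "zd_open X U" "openin X W" "x \<in> W" "W \<subseteq> U"
  obtains D where "openin X D" "compactin X D" "x \<in> D" "D \<subseteq> W"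
proof -
  let ?Y = "subtopology X U"
  have U: "openin X U" "locally_compact_space ?Y" "Hausdorff_space ?Y" "totally_disconnected_space ?Y"
    using assms(1) by (auto simp: zd_open_def lcH_open_def)
  have "lcH_open X W"
    using assms lcH_open_subset by (auto simp: zd_open_def)
  then obtain N C where N': "openin X N" "compactin X C" and xN: "x \<in> N" and N: "N \<subseteq> C" "C \<subseteq> W"
    using lcH_open_nbhd[OF _ \<open>x \<in> W\<close>] by metis
  have x: "x \<in> topspace ?Y"
    using assms(3,4) openin_subset[OF U(1)] by auto
  have "connected_component_of_set ?Y x = {x}"
  proof -
    obtain z where "connected_component_of_set ?Y x \<subseteq> {z}"
      using U(4) connectedin_connected_component_of[of ?Y x] unfolding totally_disconnected_space_def by blast
    moreover have "x \<in> connected_component_of_set ?Y x"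
      using x by (simp add: connected_component_of_refl)
    ultimately show ?thesis by blast
  qed
  then have "{x} \<in> connected_components_of ?Y"
    using x unfolding connected_components_of_def by (intro image_eqI[of _ _ x]) simp_all
  moreover have "openin ?Y N"
    using N' N assms(4) U(1) by (simp add: openin_open_subtopology)
  moreover have "compactin ?Y {x}"
    using x by simp
  ultimately obtain D E where D: "openin ?Y D" "openin ?Y E" "disjnt D E" "D \<union> E = topspace ?Y" "{x} \<subseteq> D" "D \<subseteq> N"
    using wilder_locally_compact_component_thm[OF U(2,3), of "{x}" N] xN by blast
  have "D = topspace ?Y - E"
    using D(3,4) by (auto simp: disjnt_def)
  then have "closedin ?Y D"
    using closedin_diff[OF closedin_topspace D(2)] by simp
  moreover have "compactin ?Y C"
    using N' N(2) assms(4) by (simp add: compactin_subtopology)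
  ultimately have "compactin ?Y D"
    using closed_compactin[of ?Y C D] D(6) N(1) by simp
  then have "compactin X D"
    by (simp add: compactin_subtopology)
  moreover have "openin X D"
    using openin_trans_full[OF D(1) U(1)] .
  ultimately show thesis
    using that D(5,6) N by simp
qed

section \<open>Clopen preimages and compact supports of locally constant functions\<close>

lemma locally_constant_openin_preimage:
  assumes "openin X U" "locally_constant_on X U f"
  shows "openin X {x \<in> U. P (f x)}"
proof (subst openin_subopen, intro ballI)
  fix x assume x: "x \<in> {x \<in> U. P (f x)}"
  then obtain W where W: "openin (subtopology X U) W" "x \<in> W" "\<forall>y\<in>W. f y = f x"
    using assms(2) unfolding locally_constant_on_def by blast
  then have "openin X W" "W \<subseteq> U"
    using assms(1) by (auto simp: openin_open_subtopology)
  then show "\<exists>T. openin X T \<and> x \<in> T \<and> T \<subseteq> {x \<in> U. P (f x)}"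
  proof (intro exI conjI subsetI)
    fix y assume "y \<in> W"
    then have "y \<in> U" "f y = f x"
      using W(3) \<open>W \<subseteq> U\<close> by blast+
    then show "y \<in> {x \<in> U. P (f x)}"
      using x by simp
  qed (rule \<open>openin X W\<close> \<open>x \<in> W\<close>)+
qed

lemma locally_constant_closedin_preimage:
  assumes "openin X U" "locally_constant_on X U f"
  shows "closedin (subtopology X U) {x \<in> U. P (f x)}"
proof -
  have top: "topspace (subtopology X U) = U"
    using assms(1) by (simp add: openin_subset Int_absorb1)
  have "openin (subtopology X U) {x \<in> U. \<not> P (f x)}"
    using locally_constant_openin_preimage[OF assms, of "\<lambda>z. \<not> P z"] assms(1)
    by (simp add: openin_open_subtopology)
  moreover have "topspace (subtopology X U) - {x \<in> U. P (f x)} = {x \<in> U. \<not> P (f x)}"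
    unfolding top by blast
  ultimately show ?thesis
    unfolding closedin_def top by simp
qed

lemma compactin_locally_constant_preimage:
  assumes "openin X U" "locally_constant_on X U f" "compactin X K" "K \<subseteq> U"
    and "\<And>x. x \<in> U \<Longrightarrow> P (f x) \<Longrightarrow> x \<in> K"
  shows "compactin X {x \<in> U. P (f x)}"
proof -
  have "compactin (subtopology X U) {x \<in> U. P (f x)}"
  proof (rule closed_compactin)
    show "compactin (subtopology X U) K"
      using assms(3,4) by (simp add: compactin_subtopology)
    show "{x \<in> U. P (f x)} \<subseteq> K"
      by (rule subsetI) (simp add: assms(5))
  qed (rule locally_constant_closedin_preimage[OF assms(1,2)])
  then show ?thesis
    by (simp add: compactin_subtopology)
qed

text \<open>For locally constant \<open>f\<close> the set of points where it is nonzero is clopen in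
  \<open>U\<close>, hence equal to its closure. The support therefore stays compact when
  \<open>f\<close> is regarded on another open set containing these points.\<close>

lemma Cc_ring_iff:
  assumes "openin X U"
  shows "f \<in> Cc_ring X U \<longleftrightarrow> locally_constant_on X U f \<and> compactin X {x \<in> U. f x \<noteq> 0} \<and>
    (\<forall>x. x \<notin> U \<longrightarrow> f x = 0)"
proof -
  have "compact_support_in X U f \<longleftrightarrow> compactin X {x \<in> U. f x \<noteq> 0}" if "locally_constant_on X U f"
  proof -
    have "subtopology X U closure_of {x \<in> U. f x \<noteq> 0} = {x \<in> U. f x \<noteq> 0}"
      using locally_constant_closedin_preimage[OF assms that] by (rule closure_of_closedin)
    then show ?thesis
      by (simp add: compact_support_in_def compactin_subtopology)
  qed
  then show ?thesis
    unfolding Cc_ring_def by blast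
qed

lemma locally_constant_on_diff:
  assumes "locally_constant_on X U f" "locally_constant_on X U g"
  shows "locally_constant_on X U (f - g)"
  unfolding locally_constant_on_def
proof
  fix x assume "x \<in> U"
  then obtain V W where V: "openin (subtopology X U) V" "x \<in> V" "\<forall>y\<in>V. f y = f x"
    and W: "openin (subtopology X U) W" "x \<in> W" "\<forall>y\<in>W. g y = g x"
    using assms unfolding locally_constant_on_def by metis
  have "(f - g) y = (f - g) x" if "y \<in> V \<inter> W" for y
    using V(3) W(3) that by (metis IntE fun_diff_def)
  moreover have "openin (subtopology X U) (V \<inter> W)"
    using V(1) W(1) by (rule openin_Int)
  ultimately show "\<exists>W. openin (subtopology X U) W \<and> x \<in> W \<and> (\<forall>y\<in>W. (f - g) y = (f - g) x)"
    using V(2) W(2) by blast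
qed

lemma Cc_ring_diff:
  assumes U: "openin X U" and f: "f \<in> Cc_ring X U" and g: "g \<in> Cc_ring X U"
  shows "f - g \<in> Cc_ring X U"
proof -
  have lc: "locally_constant_on X U (f - g)"
    using f g by (simp add: Cc_ring_iff[OF U] locally_constant_on_diff)
  have "compactin X ({x \<in> U. f x \<noteq> 0} \<union> {x \<in> U. g x \<noteq> 0})"
    using f g by (simp add: Cc_ring_iff[OF U] compactin_Un)
  then have "compactin X {x \<in> U. (f - g) x \<noteq> 0}"
    by (rule compactin_locally_constant_preimage[OF U lc]) auto
  then show ?thesis
    using lc f g by (simp add: Cc_ring_iff[OF U])
qed

text \<open>As for functions vanishing at infinity, the points of \<open>W\<close> outside
  \<open>U\<close> are the delicate ones: the compact set where \<open>f\<close> is nonzero is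
  closed in the Hausdorff space \<open>W\<close>, so \<open>f\<close> is \<open>0\<close> on a
  neighbourhood of such a point.\<close>

lemma Cc_ring_transfer:
  assumes U: "openin X U" and W: "lcH_open X W" and f: "f \<in> Cc_ring X U"
    and supp: "\<And>x. f x \<noteq> 0 \<Longrightarrow> x \<in> W"
  shows "f \<in> Cc_ring X W"
proof -
  have oW: "openin X W" and HW: "Hausdorff_space (subtopology X W)"
    using W by (auto simp: lcH_open_def)
  have lc: "locally_constant_on X U f" and f0: "\<And>x. x \<notin> U \<Longrightarrow> f x = 0"
    and K: "compactin X {x \<in> U. f x \<noteq> 0}"
    using f by (auto simp: Cc_ring_iff[OF U])
  have eq: "{x \<in> U. f x \<noteq> 0} = {x \<in> W. f x \<noteq> 0}"
    using f0 supp by blast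
  have "\<exists>V. openin (subtopology X W) V \<and> x \<in> V \<and> (\<forall>y\<in>V. f y = f x)" if x: "x \<in> W" for x
  proof (cases "x \<in> U")
    case True
    have "openin X {y \<in> U. f y = f x}"
      using U lc by (rule locally_constant_openin_preimage)
    then have "openin (subtopology X W) (W \<inter> {y \<in> U. f y = f x})"
      by (rule openin_subtopology_Int2)
    then show ?thesis
      using True x by (intro exI[of _ "W \<inter> {y \<in> U. f y = f x}"]) simp
  next
    case False
    have "openin X (W - {x \<in> W. f x \<noteq> 0})"
      using K unfolding eq by (intro openin_Diff_compactin oW HW) auto
    then have "openin (subtopology X W) (W - {x \<in> W. f x \<noteq> 0})"
      using oW by (simp add: openin_open_subtopology)
    then show ?thesis
      using False x f0 by (intro exI[of _ "W - {x \<in> W. f x \<noteq> 0}"]) auto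
  qed
  then have "locally_constant_on X W f"
    by (simp add: locally_constant_on_def)
  moreover have "\<forall>x. x \<notin> W \<longrightarrow> f x = 0"
    using supp by blast
  ultimately show ?thesis
    using K unfolding Cc_ring_iff[OF oW] eq by simp
qed

text \<open>The part of the support outside \<open>B\<close> is compact and lies in
  \<open>A\<close>. Finitely many compact open subsets of \<open>U \<inter> A\<close> cover it; with
  \<open>E\<close> their union, \<open>a\<close> is \<open>f\<close> cut off to
  \<open>E\<close>.\<close>

lemma Cc_ring_split:
  assumes U: "zd_open X U" and f: "f \<in> Cc_ring X U" and A: "openin X A" and B: "openin X B"
    and supp: "\<And>x. f x \<noteq> 0 \<Longrightarrow> x \<in> A \<union> B"
  shows "\<exists>a\<in>Cc_ring X U. (\<forall>x. a x \<noteq> 0 \<longrightarrow> x \<in> A) \<and> (\<forall>x. f x - a x \<noteq> 0 \<longrightarrow> x \<in> B)"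
proof -
  have oU: "openin X U" and HU: "Hausdorff_space (subtopology X U)"
    using U by (auto simp: zd_open_def lcH_open_def)
  define K where "K = {x \<in> U. f x \<noteq> 0}"
  have lc: "locally_constant_on X U f" and f0: "\<And>x. x \<notin> U \<Longrightarrow> f x = 0" and K: "compactin X K"
    using f by (auto simp: Cc_ring_iff[OF oU] K_def)
  have "closedin (subtopology X U) (topspace (subtopology X U) - U \<inter> B)"
    using B by (intro closedin_diff closedin_topspace openin_subtopology_Int2)
  moreover have "topspace (subtopology X U) - U \<inter> B = U - B"
    using openin_subset[OF oU] by auto
  ultimately have "closedin (subtopology X U) (U - B)"
    by (simp only:)
  moreover have "compactin (subtopology X U) K"
    using K by (auto simp: compactin_subtopology K_def)
  ultimately have "compactin (subtopology X U) ((U - B) \<inter> K)"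
    by (rule closed_Int_compactin)
  then have KB: "compactin X ((U - B) \<inter> K)"
    by (simp add: compactin_subtopology)
  have oAU: "openin X (U \<inter> A)"
    using oU A by (rule openin_Int)
  have "\<exists>D. openin X D \<and> compactin X D \<and> x \<in> D \<and> D \<subseteq> U \<inter> A" if "x \<in> (U - B) \<inter> K" for x
  proof -
    have "x \<in> U \<inter> A"
      using that supp by (auto simp: K_def)
    then show ?thesis
      using zd_open_compact_open[OF U oAU] by (metis inf_le1)
  qed
  then obtain D where D: "\<And>x. x \<in> (U - B) \<inter> K \<Longrightarrow>
      openin X (D x) \<and> compactin X (D x) \<and> x \<in> D x \<and> D x \<subseteq> U \<inter> A"
    by metis
  have "\<exists>\<F>. finite \<F> \<and> \<F> \<subseteq> D ` ((U - B) \<inter> K) \<and> (U - B) \<inter> K \<subseteq> \<Union>\<F>"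
    using D by (intro compactinD[OF KB]) auto
  then obtain \<F> where \<F>: "finite \<F>" "\<F> \<subseteq> D ` ((U - B) \<inter> K)" "(U - B) \<inter> K \<subseteq> \<Union>\<F>"
    by blast
  define E where "E = \<Union>\<F>"
  have E: "openin X E" "compactin X E" "E \<subseteq> U \<inter> A" "(U - B) \<inter> K \<subseteq> E"
    using \<F> D unfolding E_def by (blast intro: openin_Union compactin_Union)+
  define a where "a x = (if x \<in> E then f x else 0)" for x
  have "openin X (U - E)"
    using E by (intro openin_Diff_compactin oU HU) auto
  have lca: "locally_constant_on X U a"
    unfolding locally_constant_on_def
  proof
    fix x assume x: "x \<in> U"
    \<comment> \<open>Cutting off preserves local constancy because \<open>E\<close> is clopen in
      \<open>U\<close>: it is open as a union of open sets, and closed as a compact subset of a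
      Hausdorff space.\<close>
    define T where "T = (if x \<in> E then E \<inter> {y \<in> U. f y = f x} else U - E)"
    have "openin X T"
      using openin_Int[OF E(1) locally_constant_openin_preimage[OF oU lc, of "\<lambda>z. z = f x"]]
        \<open>openin X (U - E)\<close> by (simp add: T_def)
    moreover have "T \<subseteq> U"
      using E(3) by (auto simp: T_def)
    ultimately have "openin (subtopology X U) T"
      using oU by (simp add: openin_open_subtopology)
    then show "\<exists>W. openin (subtopology X U) W \<and> x \<in> W \<and> (\<forall>y\<in>W. a y = a x)"
      using x by (intro exI[of _ T]) (auto simp: T_def a_def)
  qed
  moreover have "compactin X {x \<in> U. a x \<noteq> 0}"
    using E by (intro compactin_locally_constant_preimage[OF oU lca E(2)]) (auto simp: a_def split: if_splits)
  moreover have "\<forall>x. x \<notin> U \<longrightarrow> a x = 0"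
    using f0 by (simp add: a_def)
  ultimately have "a \<in> Cc_ring X U"
    by (simp add: Cc_ring_iff[OF oU])
  moreover have "x \<in> A" if "a x \<noteq> 0" for x
    using that E(3) by (auto simp: a_def split: if_splits)
  moreover have "x \<in> B" if "f x - a x \<noteq> 0" for x
    using that E(4) f0[of x] by (auto simp: a_def K_def split: if_splits)
  ultimately show ?thesis
    by blast
qed

interpretation Cc_ring: soft_sections X "{U. zd_open X U}" "Cc_ring X :: 'a set \<Rightarrow> ('a \<Rightarrow> 'r::ring) set"
  for X :: "'a topology"
proof
  fix U :: "'a set"
  assume "U \<in> {U. zd_open X U}"
  then have U: "openin X U" by (simp add: zd_open_def lcH_open_def)
  then show "openin X U" .
  have "locally_constant_on X U (0 :: 'a \<Rightarrow> 'r)"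
    using U unfolding locally_constant_on_def by (auto intro!: exI[of _ U] simp: openin_open_subtopology)
  then show "(0 :: 'a \<Rightarrow> 'r) \<in> Cc_ring X U"
    by (simp add: Cc_ring_iff[OF U])
  fix f g :: "'a \<Rightarrow> 'r" assume f: "f \<in> Cc_ring X U"
  show "f - g \<in> Cc_ring X U" if "g \<in> Cc_ring X U"
    using U f that by (rule Cc_ring_diff)
  show "x \<in> U" if "f x \<noteq> 0" for x
    using f that by (auto simp: Cc_ring_def)
  show "f \<in> Cc_ring X W" if "W \<in> {U. zd_open X U}" "\<And>x. f x \<noteq> 0 \<Longrightarrow> x \<in> W" for W
    using that(1) by (intro Cc_ring_transfer[OF U _ f that(2)]) (simp_all add: zd_open_def)
next
  fix U A B :: "'a set" and f :: "'a \<Rightarrow> 'r"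
  show "\<exists>a\<in>Cc_ring X U. (\<forall>x. a x \<noteq> 0 \<longrightarrow> x \<in> A) \<and> (\<forall>x. f x - a x \<noteq> 0 \<longrightarrow> x \<in> B)"
    if "U \<in> {U. zd_open X U}" "f \<in> Cc_ring X U" "openin X A" "openin X B" "\<And>x. f x \<noteq> 0 \<Longrightarrow> x \<in> A \<union> B"
    using that(1) by (intro Cc_ring_split[OF _ that(2-5)]) simp
qed

section \<open>Open bisections of etale groupoids\<close>

context etale_groupoid
begin

lemma open_map_rng: "open_map G (subtopology G G0) rng"
  unfolding open_map_def
proof (intro allI impI)
  fix O' assume O': "openin G O'"
  show "openin (subtopology G G0) (rng ` O')"
  proof (subst openin_subopen, intro ballI)
    fix y assume "y \<in> rng ` O'"
    then obtain x where x: "x \<in> O'" "y = rng x" by blast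
    then have "x \<in> topspace G"
      using openin_subset[OF O'] by blast
    then obtain U where U: "openin G U" "x \<in> U" "openin (subtopology G G0) (rng ` U)"
      "homeomorphic_map (subtopology G U) (subtopology (subtopology G G0) (rng ` U)) rng"
      using local_homeomorphism_rng unfolding local_homeomorphism_def by blast
    have "openin (subtopology G U) (U \<inter> O')"
      using O' by (rule openin_subtopology_Int2)
    then have "openin (subtopology (subtopology G G0) (rng ` U)) (rng ` (U \<inter> O'))"
      using homeomorphic_imp_open_map[OF U(4)] unfolding open_map_def by blast
    then have "openin (subtopology G G0) (rng ` (U \<inter> O'))"
      using U(3) by (rule openin_trans_full)
    then show "\<exists>T. openin (subtopology G G0) T \<and> y \<in> T \<and> T \<subseteq> rng ` O'"
      using x U(2) by (intro exI[of _ "rng ` (U \<inter> O')"]) auto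
  qed
qed

text \<open>Local compactness passes from \<open>G\<close> to the units along the open continuous
  surjection \<open>rng\<close>.\<close>

lemma locally_compact_units: "locally_compact_space (subtopology G G0)"
proof (rule locally_compact_space_continuous_open_map_image[OF continuous_rng open_map_rng _ locally_compact])
  have "rng ` topspace G = G0"
    using rng_closed rng_unit units_subset by force
  then show "rng ` topspace G = topspace (subtopology G G0)"
    using units_subset by (simp add: Int_absorb1)
qed

text \<open>The map \<open>rng\<close> is continuous and open on all of \<open>G\<close>;
  injectivity on \<open>U\<close> makes its restriction a homeomorphism onto its image.\<close>

lemma homeomorphic_map_rng_bisection:
  assumes "open_bisection G rng src U"
  shows "homeomorphic_map (subtopology G U) (subtopology (subtopology G G0) (rng ` U)) rng"
proof (rule bijective_open_imp_homeomorphic_map)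
  have U: "openin G U" "inj_on rng U"
    using assms by (auto simp: open_bisection_def)
  then have top: "topspace G \<inter> U = U"
    by (simp add: openin_subset Int_absorb1)
  show "continuous_map (subtopology G U) (subtopology (subtopology G G0) (rng ` U)) rng"
    by (intro continuous_map_into_subtopology continuous_map_from_subtopology continuous_rng) (auto simp: top)
  show "open_map (subtopology G U) (subtopology (subtopology G G0) (rng ` U)) rng"
    unfolding open_map_def
  proof (intro allI impI)
    fix W assume "openin (subtopology G U) W"
    then have "openin G W" "W \<subseteq> U"
      using U(1) by (auto simp: openin_open_subtopology)
    then have "openin (subtopology G G0) (rng ` W)" "rng ` W \<subseteq> rng ` U"
      using open_map_rng unfolding open_map_def by blast+
    then show "openin (subtopology (subtopology G G0) (rng ` U)) (rng ` W)"
      by (metis inf.absorb_iff2 openin_subtopology_Int2)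
  qed
  have "rng ` U \<subseteq> G0"
    using rng_closed openin_subset[OF U(1)] by blast
  then show "rng ` topspace (subtopology G U) = topspace (subtopology (subtopology G G0) (rng ` U))"
    using units_subset by (auto simp: top)
  show "inj_on rng (topspace (subtopology G U))"
    using U(2) by (simp add: top)
qed

lemma lcH_open_bisection:
  assumes "open_bisection G rng src U"
  shows "lcH_open G U"
proof -
  let ?R = "subtopology (subtopology G G0) (rng ` U)"
  have U: "openin G U"
    using assms by (simp add: open_bisection_def)
  then have "openin (subtopology G G0) (rng ` U)"
    using open_map_rng unfolding open_map_def by blast
  then have "locally_compact_space ?R"
    using locally_compact_units Hausdorff_units by (blast intro: locally_compact_space_open_subset)
  moreover have "Hausdorff_space ?R"
    using Hausdorff_units by (rule Hausdorff_space_subtopology)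
  moreover have "subtopology G U homeomorphic_space ?R"
    using homeomorphic_map_rng_bisection[OF assms] by (rule homeomorphic_map_imp_homeomorphic_space)
  ultimately show ?thesis
    unfolding lcH_open_def
    using U homeomorphic_locally_compact_space homeomorphic_Hausdorff_space by blast
qed

end

text \<open>The image under \<open>rng\<close> of a connected subset of \<open>U\<close> is
  connected in the unit space, hence at most a point, and \<open>rng\<close> is injective on
  \<open>U\<close>.\<close>

lemma (in ample_groupoid) zd_open_bisection:
  assumes "open_bisection G rng src U"
  shows "zd_open G U"
proof -
  have inj: "inj_on rng U"
    using assms by (simp add: open_bisection_def)
  have "\<exists>x. C \<subseteq> {x}" if C: "connectedin (subtopology G U) C" for C
  proof -
    have C': "connectedin G C" "C \<subseteq> U"
      using C by (auto simp: connectedin_subtopology)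
    then have "connectedin (subtopology G G0) (rng ` C)"
      using connectedin_continuous_map_image[OF continuous_rng] by blast
    then obtain y where "rng ` C \<subseteq> {y}"
      using totally_disconnected_units unfolding totally_disconnected_space_def by blast
    then have "a = b" if "a \<in> C" "b \<in> C" for a b
      using inj_onD[OF inj, of a b] C'(2) that by blast
    then show ?thesis by blast
  qed
  then show ?thesis
    using lcH_open_bisection[OF assms] by (simp add: zd_open_def totally_disconnected_space_def)
qed

section \<open>Comparing the two function spaces of a groupoid with finite sums of sections\<close>

lemma group_closure_sum_mem:
  assumes "\<And>i. i \<in> I \<Longrightarrow> f i \<in> group_closure S"
  shows "(\<Sum>i\<in>I. f i) \<in> group_closure S"
  using assms by (induction I rule: infinite_finite_induct) (auto intro: group_closure_add)

text \<open>The level sets of \<open>f\<close> are open, so the compact set \<open>K\<close> meets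
  only finitely many of them. Hence \<open>f\<close> is a finite sum of constants on level sets,
  which are again open bisections as subsets of \<open>U\<close>.\<close>

lemma Cc_ring_subset_groupoid_ring:
  fixes G :: "'a topology"
  assumes "open_bisection G rng src U"
  shows "(Cc_ring G U :: ('a \<Rightarrow> 'r::ring) set) \<subseteq> groupoid_ring G rng src"
proof
  fix f :: "'a \<Rightarrow> 'r" assume f: "f \<in> Cc_ring G U"
  have U: "openin G U" "inj_on rng U" "inj_on src U"
    using assms by (auto simp: open_bisection_def)
  define K where "K = {x \<in> U. f x \<noteq> 0}"
  define L where "L c = {x \<in> U. f x = c}" for c
  have lc: "locally_constant_on G U f" and K: "compactin G K" and f0: "\<And>x. x \<notin> U \<Longrightarrow> f x = 0"
    using f by (auto simp: Cc_ring_iff[OF U(1)] K_def)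
  have oL: "openin G (L c)" for c
    unfolding L_def by (rule locally_constant_openin_preimage[OF U(1) lc])
  have "\<exists>\<F>. finite \<F> \<and> \<F> \<subseteq> range L \<and> K \<subseteq> \<Union>\<F>"
    using oL by (intro compactinD[OF K]) (auto simp: K_def L_def)
  then obtain \<F> where \<F>: "finite \<F>" "\<F> \<subseteq> range L" "K \<subseteq> \<Union>\<F>"
    by blast
  obtain T where T: "finite T" "\<F> = L ` T"
    using finite_subset_image[OF \<F>(1,2)] by blast
  have cov: "f x \<in> T" if "x \<in> K" for x
    using that \<F>(3) T(2) by (auto simp: L_def)
  have "f = (\<Sum>c\<in>T - {0}. (\<lambda>x. if x \<in> L c then c else 0))"
  proof
    fix x
    have "(\<Sum>c\<in>T - {0}. (\<lambda>x. if x \<in> L c then c else 0)) x = (\<Sum>c\<in>T - {0}. if x \<in> U \<and> c = f x then f x else 0)"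
      unfolding sum_fun_apply by (intro sum.cong) (auto simp: L_def)
    also have "\<dots> = f x"
    proof (cases "x \<in> U \<and> f x \<noteq> 0")
      case True
      then have "f x \<in> T - {0}"
        using cov by (simp add: K_def)
      then show ?thesis
        using True T(1) by simp
    next
      case False
      then show ?thesis
        using f0 by (intro sum.neutral[THEN trans]) auto
    qed
    finally show "f x = (\<Sum>c\<in>T - {0}. (\<lambda>x. if x \<in> L c then c else 0)) x" ..
  qed
  \<comment> \<open>For a nonzero value the level set lies in \<open>K\<close> and is therefore
    compact; the level set of \<open>0\<close> may fail to be.\<close>
  moreover have "(\<lambda>x. if x \<in> L c then c else 0) \<in> groupoid_ring G rng src" if "c \<in> T - {0}" for c
  proof -
    have "compactin G (L c)"
      unfolding L_def using that
      by (intro compactin_locally_constant_preimage[OF U(1) lc K]) (auto simp: K_def)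
    moreover have "open_bisection G rng src (L c)"
      using oL U(2,3) by (auto simp: open_bisection_def L_def intro: inj_on_subset)
    ultimately show ?thesis
      unfolding groupoid_ring_def by (intro group_closure.base) blast
  qed
  ultimately show "f \<in> groupoid_ring G rng src"
    unfolding groupoid_ring_def by (metis (no_types, lifting) group_closure_sum_mem)
qed

lemma (in ample_groupoid) groupoid_ring_subset_total:
  "(groupoid_ring G rng src :: ('a \<Rightarrow> 'r::ring) set) \<subseteq> Cc_ring.total G"
proof
  fix f :: "'a \<Rightarrow> 'r" assume "f \<in> groupoid_ring G rng src"
  then show "f \<in> Cc_ring.total G"
    unfolding groupoid_ring_def
  proof (induction rule: group_closure.induct)
    case (base f)
    show ?case
    \<comment> \<open>The base case of \<open>group_closure\<close> covers \<open>0\<close> besides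
      the generators.\<close>
    proof (cases "f = 0")
      case True
      then show ?thesis using Cc_ring.total_zero by (simp only:)
    next
      case False
      then obtain c U where f: "f = (\<lambda>g. if g \<in> U then c else 0)"
        and U: "open_bisection G rng src U" "compactin G U"
        using base by blast
      have zd: "zd_open G U"
        using zd_open_bisection[OF U(1)] .
      have oU: "openin G U"
        using U(1) by (simp add: open_bisection_def)
      have "locally_constant_on G U f"
        unfolding locally_constant_on_def f using oU by (auto intro!: exI[of _ U] simp: openin_open_subtopology)
      moreover have "compactin G {x \<in> U. f x \<noteq> 0}"
        using U(2) by (cases "c = 0") (simp_all add: f)
      ultimately have "f \<in> Cc_ring G U"
        using oU by (simp add: Cc_ring_iff f)
      then show ?thesis
        using zd by (intro Cc_ring.total_base) auto
    qed
  next
    case (diff s t)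
    then show ?case by (intro Cc_ring.total_diff)
  qed
qed

text \<open>\<open>total\<close> is only known to be an additive group, so the scalars of the linear
  span are absorbed into the individual summands by \<open>C0_scale\<close>.\<close>

lemma (in etale_groupoid) Cc_groupoid_subset_total: "Cc_groupoid G rng src \<subseteq> C0.total G"
proof
  fix f assume "f \<in> Cc_groupoid G rng src"
  then show "f \<in> C0.total G"
    unfolding Cc_groupoid_def
  proof (induction rule: complex_fun.span_induct_alt)
    case base
    then show ?case using C0.total_zero by (simp add: zero_fun_def)
  next
    case (step c x y)
    then obtain U where U: "open_bisection G rng src U" "x \<in> Cc G U"
      by blast
    have lcH: "lcH_open G U"
      using lcH_open_bisection[OF U(1)] .
    have "x \<in> C0 G U"
      using U lcH Cc_subset_C0 by (auto simp: lcH_open_def)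
    then have "(\<lambda>z. c * x z) \<in> C0 G U"
      by (rule C0_scale)
    then have "(\<lambda>z. c * x z) \<in> C0.total G"
      using lcH by (intro C0.total_base) auto
    then show ?case
      using step C0.total_add by (simp add: plus_fun_def)
  qed
qed

theorem corollary3p14:
  fixes G :: "'a topology"
    and G0 :: "'a set"
    and rng src :: "'a \<Rightarrow> 'a"
    and mul :: "'a \<Rightarrow> 'a \<Rightarrow> 'a"
    and ginv :: "'a \<Rightarrow> 'a"
  assumes "etale_groupoid G G0 rng src mul ginv"
  shows
    "(\<forall>(f :: 'a \<Rightarrow> complex) (n::nat) V K.
        f \<in> Cc_groupoid G rng src \<longrightarrow>
        (\<forall>i\<in>{1..n}. open_bisection G rng src (V i)) \<longrightarrow>
        compactin G K \<longrightarrow> K \<subseteq> (\<Union>i\<in>{1..n}. V i) \<longrightarrow> open_support G f \<subseteq> K \<longrightarrow>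
        (\<exists>F. (\<forall>i\<in>{1..n}. F i \<in> Cc G (V i)) \<and> f = (\<Sum>i=1..n. F i)))
     \<and>
     (ample_groupoid G G0 rng src mul ginv \<longrightarrow>
      (\<forall>(f :: 'a \<Rightarrow> 'r::ring) (n::nat) V K.
        f \<in> groupoid_ring G rng src \<longrightarrow>
        (\<forall>i\<in>{1..n}. open_bisection G rng src (V i)) \<longrightarrow>
        compactin G K \<longrightarrow> K \<subseteq> (\<Union>i\<in>{1..n}. V i) \<longrightarrow> open_support G f \<subseteq> K \<longrightarrow>
        (\<exists>F. (\<forall>i\<in>{1..n}. F i \<in> groupoid_ring G rng src \<and> F i \<in> Cc_ring G (V i)) \<and>
             f = (\<Sum>i=1..n. F i))))"
proof (intro conjI impI allI)
  interpret etale_groupoid G G0 rng src mul ginv by fact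
  fix f :: "'a \<Rightarrow> complex" and n :: nat and V K
  assume f: "f \<in> Cc_groupoid G rng src" and V: "\<forall>i\<in>{1..n}. open_bisection G rng src (V i)"
    and K: "compactin G K" "K \<subseteq> (\<Union>i\<in>{1..n}. V i)" and supp: "open_support G f \<subseteq> K"
  have lcV: "lcH_open G (V i)" if "i \<in> {1..n}" for i
    using V that lcH_open_bisection by blast
  \<comment> \<open>Redistributing over the smaller sets \<open>V' i\<close> yields functions that
    only vanish at infinity on \<open>V' i\<close>, but the compact sets \<open>C i\<close> between
    \<open>V' i\<close> and \<open>V i\<close> give them compact support in
    \<open>V i\<close>.\<close>
  obtain V' C where V': "\<And>i. i \<in> {1..n} \<Longrightarrow> openin G (V' i)"
    and C: "\<And>i. i \<in> {1..n} \<Longrightarrow> compactin G (C i)"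
      "\<And>i. i \<in> {1..n} \<Longrightarrow> V' i \<subseteq> C i" "\<And>i. i \<in> {1..n} \<Longrightarrow> C i \<subseteq> V i"
    and KV': "K \<subseteq> (\<Union>i\<in>{1..n}. V' i)"
    using shrink_cover[OF _ lcV K] by (metis finite_atLeastAtMost)
  have lcV': "lcH_open G (V' i)" if "i \<in> {1..n}" for i
    using lcH_open_subset[OF lcV[OF that] V'[OF that]] C(2,3)[OF that] by blast
  have ft: "f \<in> C0.total G"
    using f Cc_groupoid_subset_total by blast
  have "\<exists>H. (\<forall>W\<in>V' ` {1..n}. H W \<in> C0 G W) \<and> f = (\<Sum>W\<in>V' ` {1..n}. H W)"
  proof (rule C0.redistribute[OF ft])
    show "V' ` {1..n} \<subseteq> {U. lcH_open G U}"
      using lcV' by blast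
    \<comment> \<open>\<open>open_support\<close> records only points of \<open>topspace G\<close>;
      that \<open>f\<close> vanishes elsewhere comes from \<open>total_vanish\<close>.\<close>
    show "x \<in> \<Union>(V' ` {1..n})" if "f x \<noteq> 0" for x
      using C0.total_vanish[OF ft that] that supp KV' by (auto simp: open_support_def)
  qed simp
  then obtain H where H: "\<forall>W\<in>V' ` {1..n}. H W \<in> C0 G W" "f = (\<Sum>W\<in>V' ` {1..n}. H W)"
    by blast
  \<comment> \<open>The decomposition so far is indexed by the distinct sets among the
    \<open>V' i\<close>; it is now reindexed by \<open>1..n\<close>.\<close>
  have "\<exists>F. (\<forall>i\<in>{1..n}. F i \<in> C0 G (V' i)) \<and> (\<Sum>W\<in>V' ` {1..n}. H W) = (\<Sum>i=1..n. F i)"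
    using H(1) C0_zero by (intro ex_indexed_sum) auto
  then obtain F where F: "\<And>i. i \<in> {1..n} \<Longrightarrow> F i \<in> C0 G (V' i)" "f = (\<Sum>i=1..n. F i)"
    using H(2) by metis
  have "F i \<in> Cc G (V i)" if "i \<in> {1..n}" for i
    using C0_mem_Cc[OF lcV[OF that] lcV'[OF that] C(2,3,1)[OF that] F(1)[OF that]] .
  with F(2) show "\<exists>F. (\<forall>i\<in>{1..n}. F i \<in> Cc G (V i)) \<and> f = (\<Sum>i=1..n. F i)"
    by blast
next
  assume "ample_groupoid G G0 rng src mul ginv"
  then interpret ample_groupoid G G0 rng src mul ginv .
  fix f :: "'a \<Rightarrow> 'r" and n :: nat and V K
  assume f: "f \<in> groupoid_ring G rng src" and V: "\<forall>i\<in>{1..n}. open_bisection G rng src (V i)"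
    and "K \<subseteq> (\<Union>i\<in>{1..n}. V i)" "open_support G f \<subseteq> K"
  then have supp: "open_support G f \<subseteq> (\<Union>i\<in>{1..n}. V i)"
    by (meson order_trans)
  have zdV: "V ` {1..n} \<subseteq> {U. zd_open G U}"
    using V zd_open_bisection by blast
  have ft: "f \<in> Cc_ring.total G"
    using f groupoid_ring_subset_total by blast
  \<comment> \<open>Sections in \<open>Cc_ring\<close> have compact support from the outset, so the
    redistribution runs directly over the sets \<open>V i\<close>.\<close>
  have "\<exists>H. (\<forall>W\<in>V ` {1..n}. H W \<in> Cc_ring G W) \<and> f = (\<Sum>W\<in>V ` {1..n}. H W)"
  proof (rule Cc_ring.redistribute[OF ft _ zdV])
    show "x \<in> \<Union>(V ` {1..n})" if "f x \<noteq> 0" for x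
      using Cc_ring.total_vanish[OF ft that] that supp by (auto simp: open_support_def)
  qed simp
  then obtain H where H: "\<forall>W\<in>V ` {1..n}. H W \<in> Cc_ring G W" "f = (\<Sum>W\<in>V ` {1..n}. H W)"
    by blast
  have "\<exists>F. (\<forall>i\<in>{1..n}. F i \<in> Cc_ring G (V i)) \<and> (\<Sum>W\<in>V ` {1..n}. H W) = (\<Sum>i=1..n. F i)"
  proof (rule ex_indexed_sum)
    show "H (V i) \<in> Cc_ring G (V i)" if "i \<in> {1..n}" for i
      using H(1) that by blast
    show "0 \<in> Cc_ring G (V i)" if "i \<in> {1..n}" for i
      using zdV that by (intro Cc_ring.zero_mem) blast
  qed simp
  then obtain F where F: "\<forall>i\<in>{1..n}. F i \<in> Cc_ring G (V i)" "f = (\<Sum>i=1..n. F i)"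
    using H(2) by metis
  moreover have "\<forall>i\<in>{1..n}. F i \<in> groupoid_ring G rng src"
    using F(1) V Cc_ring_subset_groupoid_ring by blast
  ultimately show "\<exists>F. (\<forall>i\<in>{1..n}. F i \<in> groupoid_ring G rng src \<and> F i \<in> Cc_ring G (V i)) \<and>
      f = (\<Sum>i=1..n. F i)"
    by blast
qed

end
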